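(* For every integer $k\ge 14$, $r_k(k+1,k+1)>\left(\operatorname{twr}_{\lfloor k/2\rfloor-4}(2)\right)^2$.
   Context: The Ramsey number $r_k(s,m)$ is the smallest integer $N$ such that every red/blue coloring of the $k$-element subsets of $[N]=\{1,\dots,N\}$ contains either an $s$-element subset of $[N]$ all of whose $k$-subsets are red or an $m$-element subset of $[N]$ all of whose $k$-subsets are blue. The tower function is defined by $\operatorname{twr}_1(x)=x$ and $\operatorname{twr}_{i+1}(x)=2^{\operatorname{twr}_i(x)}$. *)

theory Defs
  imports Complex_Main "HOL-Library.Ramsey"
begin

text \<open>
  A red/blue colouring of the \<open>k\<close>-subsets of \<open>{1..N}\<close> is a map from \<open>nsets {1..N} k\<close> into
  \<open>{..<2}\<close>, with \<open>0\<close> read as red and \<open>1\<close> as blue. Then \<open>partn_lst {1..N} [s, m] k\<close> says that every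
  such colouring has a red \<open>s\<close>-set or a blue \<open>m\<close>-set; \<open>partn_lst_two_colours_iff\<close> spells this out.
\<close>

definition ramsey_number :: "nat \<Rightarrow> nat \<Rightarrow> nat \<Rightarrow> nat"
  where "ramsey_number k s m = (LEAST N. partn_lst {1..N} [s, m] k)"

text \<open>The tower function is indexed from \<open>1\<close>; the value at index \<open>0\<close> is a dummy.\<close>

fun twr :: "nat \<Rightarrow> nat \<Rightarrow> nat"
  where
    "twr 0 x = x"
  | "twr (Suc 0) x = x"
  | "twr (Suc (Suc i)) x = 2 ^ twr (Suc i) x"

lemma partn_lst_two_colours_iff:
  "partn_lst A [s, m] k \<longleftrightarrow>
    (\<forall>f \<in> nsets A k \<rightarrow> {0, 1::nat}.
      (\<exists>S \<in> nsets A s. \<forall>e \<in> nsets S k. f e = 0) \<or>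
      (\<exists>M \<in> nsets A m. \<forall>e \<in> nsets M k. f e = 1))"
proof -
  have "{..<length [s, m]} = {0, 1::nat}"
    by auto
  moreover have "(\<exists>i<length [s, m]. P i) \<longleftrightarrow> P 0 \<or> P 1" for P
    by (auto simp: less_Suc_eq)
  ultimately show ?thesis
    unfolding partn_lst_def monochromatic_def by (simp add: image_subset_iff)
qed

lemma partn_lst_shift:
  fixes N :: nat
  assumes "partn_lst {..<N} qs k"
  shows "partn_lst {1..N} qs k"
  unfolding partn_lst_def
proof
  fix f :: "nat set \<Rightarrow> nat"
  assume f: "f \<in> nsets {1..N} k \<rightarrow> {..<length qs}"
  have img: "Suc ` X \<in> nsets {1..N} n" if "X \<in> nsets {..<N} n" for X n
    using that by (fastforce simp: nsets_def card_image)
  have "(\<lambda>X. f (Suc ` X)) \<in> nsets {..<N} k \<rightarrow> {..<length qs}"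
    using f img by auto
  then obtain i H where i: "i < length qs" and H: "H \<in> nsets {..<N} (qs ! i)"
    and mono: "(\<lambda>X. f (Suc ` X)) ` nsets H k \<subseteq> {i}"
    using assms by (metis partn_lstE)
  have "f ` nsets (Suc ` H) k \<subseteq> {i}"
  proof clarify
    fix Y assume Y: "Y \<in> nsets (Suc ` H) k"
    then obtain X where "X \<subseteq> H" "Y = Suc ` X"
      by (auto simp: nsets_def subset_image_iff)
    with Y have "X \<in> nsets H k"
      by (auto simp: nsets_def card_image finite_image_iff)
    with mono \<open>Y = Suc ` X\<close> show "f Y = i"
      by auto
  qed
  then show "\<exists>i<length qs. monochromatic {1..N} (qs ! i) k f i"
    using i img[OF H] by (auto simp: monochromatic_def)
qed

text \<open>By Ramsey's theorem, the minimum in the definition is attained.\<close>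

lemma ramsey_number_partn: "partn_lst {1..ramsey_number k s m} [s, m] k"
  unfolding ramsey_number_def
  by (rule LeastI_ex) (use ramsey_full partn_lst_shift in blast)

lemma ramsey_number_le: "partn_lst {1..N} [s, m] k \<Longrightarrow> ramsey_number k s m \<le> N"
  unfolding ramsey_number_def by (rule Least_le)

end

theory Submission
  imports Defs
begin

text \<open>
  Let \<open>h = k div 2\<close> and split a \<open>k\<close>-set into its \<open>h\<close> smallest elements \<open>A\<close> and the remaining
  elements \<open>B\<close>. A \<open>(k + 1)\<close>-set is \<open>A \<union> {c} \<union> B\<close> with \<open>A < c < B\<close>. Deleting \<open>c\<close> leaves the
  parts \<open>A\<close> and \<open>B\<close>; deleting the minimum (maximum) instead keeps \<open>B\<close> (\<open>A\<close>) and replaces the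
  other part by a neighbour in a shift graph. So if shift graphs on \<open>h\<close>-sets map homomorphically to a fixed digraph
  \<open>D\<close>, it is enough to 2-colour pairs of vertices of \<open>D\<close> such that no pair agrees both with one
  obtained by a step in the first coordinate and with one obtained by a step back in the second. The
  digraph \<open>marker_arc\<close>, on four vertices, admits the colouring \<open>(s, b), (t, d) \<mapsto> b + d + s t\<close>
  over the field with two elements.

  A homomorphism from the shift graph on \<open>j\<close>-sets into \<open>E'\<close> yields one from the shift graph on
  \<open>(j + 1)\<close>-sets into \<open>E\<close> as soon as the line digraph of \<open>E'\<close> maps to \<open>E\<close>. The complete digraph
  on \<open>2n choose n\<close> vertices maps in this way to the one on \<open>2n\<close> vertices, which accounts for the
  tower, and four more steps lead from the complete digraph on six vertices to \<open>marker_arc\<close>.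
\<close>

section \<open>Homomorphisms from shift graphs\<close>

definition shift_colourable :: "nat set \<Rightarrow> nat \<Rightarrow> ('c \<times> 'c) set \<Rightarrow> bool"
  where "shift_colourable X j E \<longleftrightarrow>
    (\<exists>\<phi>. \<forall>T \<in> nsets X (Suc j). (\<phi> (T - {Max T}), \<phi> (T - {Min T})) \<in> E)"

definition complete_arcs :: "nat \<Rightarrow> (nat \<times> nat) set"
  where "complete_arcs n = {(x, y). x < n \<and> y < n \<and> x \<noteq> y}"

lemma shift_colourable_mono:
  "shift_colourable X j E \<Longrightarrow> E \<subseteq> E' \<Longrightarrow> shift_colourable X j E'"
  unfolding shift_colourable_def by blast

lemma complete_arcs_mono: "m \<le> n \<Longrightarrow> complete_arcs m \<subseteq> complete_arcs n"
  unfolding complete_arcs_def by auto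

lemma shift_colourable_complete: "shift_colourable {1..N} 1 (complete_arcs N)"
  unfolding shift_colourable_def
proof (intro exI ballI)
  fix T assume "T \<in> nsets {1..N} (Suc 1)"
  then obtain x y where T: "T = {x, y}" "x \<in> {1..N}" "y \<in> {1..N}" "x < y"
    using ordered_nsets_2_eq[of "{1..N}"] by (auto simp: numeral_2_eq_2)
  then have eqs: "T - {Max T} = {x}" "T - {Min T} = {y}"
    by auto
  show "(Min (T - {Max T}) - 1, Min (T - {Min T}) - 1) \<in> complete_arcs N"
    unfolding eqs using T(2-4) by (auto simp: complete_arcs_def)
qed

text \<open>A set is coloured by \<open>c\<close> on the arc between its two truncations. Removing
  the minimum and removing the maximum commute, so the arcs before and after a shift share their
  middle vertex.\<close>

lemma shift_colourable_line:
  assumes E: "shift_colourable X j E" and "j \<ge> 1"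
    and c: "\<And>x y z. (x, y) \<in> E \<Longrightarrow> (y, z) \<in> E \<Longrightarrow> (c x y, c y z) \<in> E'"
  shows "shift_colourable X (Suc j) E'"
proof -
  obtain \<phi> where \<phi>: "(\<phi> (T - {Max T}), \<phi> (T - {Min T})) \<in> E" if "T \<in> nsets X (Suc j)" for T
    using E unfolding shift_colourable_def by blast
  let ?\<psi> = "\<lambda>T. c (\<phi> (T - {Max T})) (\<phi> (T - {Min T}))"
  have "(?\<psi> (T - {Max T}), ?\<psi> (T - {Min T})) \<in> E'" if T: "T \<in> nsets X (Suc (Suc j))" for T
  proof -
    have fin: "finite T" and cT: "card T = Suc (Suc j)"
      using T by (auto simp: nsets_def)
    then have ne: "T \<noteq> {}" by auto
    have MT: "Max T \<in> T" "Min T \<in> T" using fin ne by auto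
    have cards: "card (T - {Max T}) = Suc j" "card (T - {Min T}) = Suc j"
      using fin cT MT by auto
    have neq: "Max T \<noteq> Min T"
    proof
      assume "Max T = Min T"
      then have "T \<subseteq> {Min T}"
        using fin by (metis Max_ge Min_le dual_order.antisym insertCI subsetI)
      then have "card T \<le> 1"
        using card_mono[of "{Min T}" T] by simp
      then show False using cT by simp
    qed
    have "Min T \<in> T - {Max T}" "Max T \<in> T - {Min T}"
      using MT neq by (metis DiffI singletonD)+
    then have mm: "Min (T - {Max T}) = Min T" "Max (T - {Min T}) = Max T"
      using fin by (intro Min_eqI Max_eqI; simp)+
    have sub: "T - {Max T} \<in> nsets X (Suc j)" "T - {Min T} \<in> nsets X (Suc j)"
      using T fin cards by (auto simp: nsets_def)
    have swap: "T - {Max T} - {Min T} = T - {Min T} - {Max T}"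
      by blast
    show ?thesis
      using \<phi>[OF sub(1)] \<phi>[OF sub(2)] unfolding mm swap by (rule c)
  qed
  then show ?thesis
    unfolding shift_colourable_def by (intro exI[of _ ?\<psi>] ballI)
qed

text \<open>The choice \<open>c x y = y\<close> keeps \<open>E\<close> unchanged. This serves odd
  \<open>k\<close>, where the upper half has one element more than the lower one.\<close>

lemma shift_colourable_le:
  assumes "j \<le> j'" and "shift_colourable X j E" and "j \<ge> 1"
  shows "shift_colourable X j' E"
  using assms(1)
proof (induction rule: dec_induct)
  case (step n)
  then show ?case
    using shift_colourable_line[of X n E "\<lambda>x y. y" E] \<open>j \<ge> 1\<close> by simp
qed (rule assms)

text \<open>
  Line digraph homomorphisms have this form: \<open>A x\<close> and \<open>B x\<close> collect the colours of the arcs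
  entering and leaving \<open>x\<close>.
\<close>

lemma shift_colourable_biclique:
  assumes "shift_colourable X j E'" and "j \<ge> 1"
    and meet: "\<And>x y. (x, y) \<in> E' \<Longrightarrow> B x \<inter> A y \<noteq> {}"
    and biclique: "\<And>x y. (x, y) \<in> E' \<Longrightarrow> A y \<times> B y \<subseteq> E"
  shows "shift_colourable X (Suc j) E"
proof (rule shift_colourable_line[OF assms(1,2)])
  fix x y z assume xy: "(x, y) \<in> E'" and yz: "(y, z) \<in> E'"
  let ?c = "\<lambda>x y. SOME v. v \<in> B x \<inter> A y"
  have "?c x y \<in> B x \<inter> A y" "?c y z \<in> B y \<inter> A z"
    using meet[OF xy] meet[OF yz] by (metis some_in_eq)+
  then show "(?c x y, ?c y z) \<in> E"
    using biclique[OF xy] by blast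
qed

section \<open>The tower\<close>

text \<open>The vertices are the \<open>n\<close>-subsets of a \<open>2n\<close>-set, each taken
  with its complement. They form an antichain, so each meets the complement of every other.\<close>

lemma shift_colourable_central_binomial:
  assumes "shift_colourable X j (complete_arcs ((2 * n) choose n))" and "j \<ge> 1"
  shows "shift_colourable X (Suc j) (complete_arcs (2 * n))"
proof -
  let ?S = "nsets {0..<2 * n} n"
  have "finite ?S" "card ?S = (2 * n) choose n"
    by (simp_all add: finite_imp_finite_nsets)
  then obtain e where e: "bij_betw e {0..<(2 * n) choose n} ?S"
    using ex_bij_betw_nat_finite by metis
  show ?thesis
  proof (rule shift_colourable_biclique[OF assms, where B = e and A = "\<lambda>x. {0..<2 * n} - e x"])
    fix x y assume xy: "(x, y) \<in> complete_arcs ((2 * n) choose n)"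
    then have S: "e x \<in> ?S" "e y \<in> ?S" and neq: "e x \<noteq> e y"
      using e by (auto simp: complete_arcs_def bij_betw_def inj_on_def)
    have "\<not> e x \<subseteq> e y"
      using S neq card_subset_eq[of "e y" "e x"] by (auto simp: nsets_def)
    with S show "e x \<inter> ({0..<2 * n} - e y) \<noteq> {}"
      by (auto simp: nsets_def)
    show "({0..<2 * n} - e y) \<times> e y \<subseteq> complete_arcs (2 * n)"
      using S by (auto simp: nsets_def complete_arcs_def)
  qed
qed

lemma two_power_le_central_binomial: "2 ^ n \<le> (2 * n) choose n"
proof -
  have "2 ^ n = (\<Sum>k\<le>n. n choose k)"
    by (simp add: choose_row_sum)
  also have "\<dots> \<le> (\<Sum>k\<le>n. (n choose k)\<^sup>2)"
    by (intro sum_mono) (simp add: power2_eq_square Suc_le_eq)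
  also have "\<dots> = (2 * n) choose n"
    by (rule choose_square_sum)
  finally show ?thesis .
qed

text \<open>With \<open>n = 2 * t\<close> the binomial step leaves \<open>4 * t\<close> colours; the
  square absorbs the factor 4 because \<open>t \<ge> 4\<close>.\<close>

lemma shift_colourable_square:
  assumes "shift_colourable X j (complete_arcs ((2 ^ t)\<^sup>2))" and "j \<ge> 1" and "t \<ge> 4"
  shows "shift_colourable X (Suc j) (complete_arcs (t\<^sup>2))"
proof -
  have "(2 ^ t)\<^sup>2 = (2::nat) ^ (2 * t)"
    by (simp add: power_mult[symmetric] mult.commute)
  also have "\<dots> \<le> (2 * (2 * t)) choose (2 * t)"
    by (rule two_power_le_central_binomial)
  finally have "shift_colourable X j (complete_arcs ((2 * (2 * t)) choose (2 * t)))"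
    using assms(1) shift_colourable_mono complete_arcs_mono by blast
  then have "shift_colourable X (Suc j) (complete_arcs (2 * (2 * t)))"
    using \<open>j \<ge> 1\<close> by (rule shift_colourable_central_binomial)
  moreover have "2 * (2 * t) \<le> t\<^sup>2"
    using mult_le_mono1[OF \<open>t \<ge> 4\<close>, of t] by (simp add: power2_eq_square)
  ultimately show ?thesis
    using shift_colourable_mono complete_arcs_mono by blast
qed

lemma twr_ge_4: "twr (Suc (Suc i)) 2 \<ge> 4"
proof (induction i)
  case (Suc i)
  have "(4::nat) \<le> 2 ^ 4" by simp
  also have "\<dots> \<le> 2 ^ twr (Suc (Suc i)) 2"
    using Suc by (intro power_increasing) auto
  finally show ?case by simp
qed simp

text \<open>Each step removes one exponential, down to \<open>twr 2 2 = 4\<close>, whose square is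
  16.\<close>

lemma shift_colourable_tower:
  assumes "shift_colourable X j (complete_arcs ((twr (Suc (Suc i)) 2)\<^sup>2))" and "j \<ge> 1"
  shows "shift_colourable X (j + i) (complete_arcs 16)"
  using assms
proof (induction i arbitrary: j)
  case (Suc i)
  have "shift_colourable X (Suc j) (complete_arcs ((twr (Suc (Suc i)) 2)\<^sup>2))"
    using Suc.prems twr_ge_4 by (intro shift_colourable_square) auto
  then show ?case
    using Suc.IH[of "Suc j"] by simp
qed simp

section \<open>From six colours to the marker digraph\<close>

text \<open>
  Along a walk, the first component marks vertices, no two consecutive ones, and the second component
  alternates except on the arcs that enter a marked vertex.
\<close>

definition marker_arc :: "(bool \<times> bool) \<times> (bool \<times> bool) \<Rightarrow> bool"
  where "marker_arc = (\<lambda>((s, b), (s', b')). \<not> (s \<and> s') \<and> b' = (b = s'))"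

text \<open>A vertex is an index into the list of bicliques. Lists and Boolean predicates allow the
  finite checks to be done by evaluation.\<close>

definition biclique_arc :: "('a list \<times> 'a list) list \<Rightarrow> nat \<times> nat \<Rightarrow> bool"
  where "biclique_arc ps = (\<lambda>(x, y). x < length ps \<and> y < length ps \<and>
    (\<exists>z \<in> set (snd (ps ! x)). z \<in> set (fst (ps ! y))))"

definition are_bicliques :: "('a list \<times> 'a list) list \<Rightarrow> ('a \<times> 'a \<Rightarrow> bool) \<Rightarrow> bool"
  where "are_bicliques ps E \<longleftrightarrow> (\<forall>(as, bs) \<in> set ps. \<forall>a \<in> set as. \<forall>b \<in> set bs. E (a, b))"

lemma shift_colourable_biclique_arc:
  assumes "shift_colourable X j (Collect (biclique_arc ps))" and "j \<ge> 1"
    and "are_bicliques ps E"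
  shows "shift_colourable X (Suc j) (Collect E)"
proof (rule shift_colourable_biclique[OF assms(1,2),
      where B = "\<lambda>x. set (snd (ps ! x))" and A = "\<lambda>x. set (fst (ps ! x))"])
  fix x y assume xy: "(x, y) \<in> Collect (biclique_arc ps)"
  then show "set (snd (ps ! x)) \<inter> set (fst (ps ! y)) \<noteq> {}"
    by (auto simp: biclique_arc_def)
  from xy have "ps ! y \<in> set ps"
    by (simp add: biclique_arc_def)
  with assms(3) show "set (fst (ps ! y)) \<times> set (snd (ps ! y)) \<subseteq> Collect E"
    unfolding are_bicliques_def by (cases "ps ! y") fastforce
qed

text \<open>
  The pairs were found by computer, by iterating the right adjoint of the line digraph construction
  (whose vertices are the maximal bicliques) on \<open>marker_arc\<close> until a complete digraph on six
  vertices appeared, and discarding what that subgraph does not need.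
\<close>

definition bicliques1 :: "((bool \<times> bool) list \<times> (bool \<times> bool) list) list"
  where "bicliques1 =
   [([(False, False), (True, False)], [(False, True)]),
    ([(False, False)], [(False, True), (True, False)]),
    ([(False, True)], [(False, False), (True, True)]),
    ([(False, True), (True, True)], [(False, False)])]"

definition bicliques2 :: "(nat list \<times> nat list) list"
  where "bicliques2 =
   [([0, 1, 2], [3]), ([1], [0, 2, 3]), ([0, 1], [2, 3]), ([1, 2], [0, 3]), ([2, 3], [0, 1]),
    ([2], [0, 1, 3]), ([1, 2, 3], [0])]"

definition bicliques3 :: "(nat list \<times> nat list) list"
  where "bicliques3 =
   [([0, 1, 2, 3, 5], [4, 6]), ([1, 3, 5], [0, 2, 4, 6]), ([1, 4, 5], [0, 2, 3, 6]),
    ([1, 2, 5], [0, 3, 4, 6]), ([1, 2, 3, 5], [0, 4, 6]), ([1, 3, 4, 5], [0, 2, 6]),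
    ([1, 2, 4, 5], [0, 3, 6]), ([1, 3, 4, 5, 6], [0, 2]), ([1, 2], [0, 3, 4, 5, 6]),
    ([4, 5], [0, 1, 2, 3, 6])]"

definition bicliques4 :: "(nat list \<times> nat list) list"
  where "bicliques4 =
   [([1, 3, 4, 8, 9], [0, 2, 5, 6, 7]), ([1, 2, 5, 8, 9], [0, 3, 4, 6, 7]),
    ([0, 1, 3, 4, 8], [2, 5, 6, 7, 9]), ([1, 2, 5, 7, 9], [0, 3, 4, 6, 8]),
    ([1, 2, 3, 8, 9], [0, 4, 5, 6, 7]), ([2, 3, 6, 8, 9], [0, 1, 4, 5, 7])]"

lemma complete_biclique_arc:
  "\<forall>x \<in> set [0..<6]. \<forall>y \<in> set [0..<6]. x \<noteq> y \<longrightarrow> biclique_arc bicliques4 (x, y)"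
  by code_simp

lemma are_bicliques4: "are_bicliques bicliques4 (biclique_arc bicliques3)"
  by code_simp

lemma are_bicliques3: "are_bicliques bicliques3 (biclique_arc bicliques2)"
  by code_simp

lemma are_bicliques2: "are_bicliques bicliques2 (biclique_arc bicliques1)"
  by code_simp

lemma are_bicliques1: "are_bicliques bicliques1 marker_arc"
  by code_simp

lemma shift_colourable_marker_arc:
  assumes "shift_colourable X j (complete_arcs 6)" and "j \<ge> 1"
  shows "shift_colourable X (j + 4) (Collect marker_arc)"
proof -
  have "complete_arcs 6 \<subseteq> Collect (biclique_arc bicliques4)"
    using complete_biclique_arc by (auto simp: complete_arcs_def)
  with assms(1) have "shift_colourable X j (Collect (biclique_arc bicliques4))"
    by (rule shift_colourable_mono)
  then have "shift_colourable X (Suc j) (Collect (biclique_arc bicliques3))"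
    using assms(2) are_bicliques4 by (rule shift_colourable_biclique_arc)
  then have "shift_colourable X (Suc (Suc j)) (Collect (biclique_arc bicliques2))"
    by (rule shift_colourable_biclique_arc) (simp_all add: are_bicliques3)
  then have "shift_colourable X (Suc (Suc (Suc j))) (Collect (biclique_arc bicliques1))"
    by (rule shift_colourable_biclique_arc) (simp_all add: are_bicliques2)
  then have "shift_colourable X (Suc (Suc (Suc (Suc j)))) (Collect marker_arc)"
    by (rule shift_colourable_biclique_arc) (simp_all add: are_bicliques1)
  then show ?thesis
    by (simp add: eval_nat_numeral)
qed

section \<open>Colouring by halves\<close>

text \<open>Addition modulo 2 is inequality on \<^typ>\<open>bool\<close>.\<close>

definition marker_sum :: "bool \<times> bool \<Rightarrow> bool \<times> bool \<Rightarrow> bool"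
  where "marker_sum p q = ((snd p \<noteq> snd q) \<noteq> (fst p \<and> fst q))"

text \<open>Modulo 2, two agreements would mean \<open>s' + s' t + s t = 1\<close> and
  \<open>t + s t' + s t = 1\<close>. If \<open>t = 0\<close>, then \<open>s = 1\<close> and
  \<open>s' = 1\<close>, which the first arc forbids. If \<open>t = 1\<close>, then
  \<open>t' = 0\<close> by the second arc, and the equations give both \<open>s = 1\<close> and
  \<open>s = 0\<close>.\<close>

lemma marker_sum_step:
  assumes "marker_arc (p, p')" and "marker_arc (q', q)"
  shows "marker_sum p' q \<noteq> marker_sum p q \<or> marker_sum p q' \<noteq> marker_sum p q"
proof -
  obtain s b s' b' t d t' d' where "p = (s, b)" "p' = (s', b')" "q = (t, d)" "q' = (t', d')"
    by (metis surj_pair)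
  with assms show ?thesis
    unfolding marker_arc_def marker_sum_def
    by (cases s; cases s'; cases t; cases t'; simp; cases b; cases d'; simp)
qed

definition lower_part :: "nat \<Rightarrow> nat set \<Rightarrow> nat set"
  where "lower_part h S = {x \<in> S. card {y \<in> S. y < x} < h}"

lemma lower_part_Un:
  assumes "finite A" "finite B" "card A = h" and less: "\<And>a b. a \<in> A \<Longrightarrow> b \<in> B \<Longrightarrow> a < b"
  shows "lower_part h (A \<union> B) = A"
proof -
  have "card {y \<in> A \<union> B. y < x} < h" if "x \<in> A" for x
  proof -
    have "{y \<in> A \<union> B. y < x} \<subset> A"
      using that less by force
    then show ?thesis
      using assms psubset_card_mono by blast
  qed
  moreover have "\<not> card {y \<in> A \<union> B. y < x} < h" if "x \<in> B" for x
  proof -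
    have "A \<subseteq> {y \<in> A \<union> B. y < x}"
      using that less by auto
    then show ?thesis
      using assms card_mono[of "{y \<in> A \<union> B. y < x}" A] by simp
  qed
  ultimately show ?thesis
    unfolding lower_part_def by blast
qed

lemma split_at_rank:
  fixes T :: "nat set"
  assumes "finite T" "m < card T"
  obtains A c B where "T = A \<union> {c} \<union> B" "card A = m" "Suc (m + card B) = card T"
    "\<And>a. a \<in> A \<Longrightarrow> a < c" "\<And>b. b \<in> B \<Longrightarrow> c < b"
proof -
  define l where "l = sorted_list_of_set T"
  have l: "sorted_wrt (<) l" "set l = T" "length l = card T" "distinct l"
    using assms by (auto simp: l_def)
  have eq: "l = take m l @ l ! m # drop (Suc m) l"
    using assms l by (metis id_take_nth_drop)
  have "sorted_wrt (<) (take m l @ l ! m # drop (Suc m) l)"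
    using l(1) eq by metis
  then have lt: "\<forall>x \<in> set (take m l). x < l ! m" "\<forall>y \<in> set (drop (Suc m) l). l ! m < y"
    by (auto simp: sorted_wrt_append)
  have "T = set (take m l @ l ! m # drop (Suc m) l)"
    using l(2) eq by metis
  then have T: "T = set (take m l) \<union> {l ! m} \<union> set (drop (Suc m) l)"
    by auto
  have "card (set (take m l)) = m" "Suc (m + card (set (drop (Suc m) l))) = card T"
    using l assms by (simp_all add: distinct_card)
  with T lt that show thesis by blast
qed

lemma not_partn_lst_halves:
  assumes \<phi>: "shift_colourable X h (Collect marker_arc)"
    and \<psi>: "shift_colourable X h' (Collect marker_arc)"
  shows "\<not> partn_lst X [h + h' + 1, h + h' + 1] (h + h')"
proof
  assume "partn_lst X [h + h' + 1, h + h' + 1] (h + h')"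
  obtain \<phi> where \<phi>: "marker_arc (\<phi> (T - {Max T}), \<phi> (T - {Min T}))"
    if "T \<in> nsets X (Suc h)" for T
    using \<phi> unfolding shift_colourable_def by blast
  obtain \<psi> where \<psi>: "marker_arc (\<psi> (T - {Max T}), \<psi> (T - {Min T}))"
    if "T \<in> nsets X (Suc h')" for T
    using \<psi> unfolding shift_colourable_def by blast
  define g where "g S = marker_sum (\<phi> (lower_part h S)) (\<psi> (S - lower_part h S))" for S
  have "(\<lambda>S. of_bool (g S)) \<in> nsets X (h + h') \<rightarrow> {0, 1::nat}"
    by auto
  from \<open>partn_lst _ _ _\<close>[unfolded partn_lst_two_colours_iff, rule_format, OF this]
  obtain T where T: "T \<in> nsets X (h + h' + 1)"
    and mono: "(\<forall>S \<in> nsets T (h + h'). \<not> g S) \<or> (\<forall>S \<in> nsets T (h + h'). g S)"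
    by (simp del: One_nat_def) blast
  have finT: "finite T" "h < card T" and cT: "card T = h + h' + 1" and TX: "T \<subseteq> X"
    using T by (auto simp: nsets_def)
  from finT obtain A c B where TABC: "T = A \<union> {c} \<union> B" and cA: "card A = h"
    and "Suc (h + card B) = card T"
    and Ac: "\<And>a. a \<in> A \<Longrightarrow> a < c" and cB: "\<And>b. b \<in> B \<Longrightarrow> c < b"
    by (rule split_at_rank) blast
  then have cB': "card B = h'" using cT by simp
  have fin: "finite A" "finite B"
    using finT TABC by auto
  define P where "P = insert c A"
  define Q where "Q = insert c B"
  have "c \<notin> A" "c \<notin> B" using Ac cB by auto
  then have PQ: "P \<in> nsets X (Suc h)" "Q \<in> nsets X (Suc h')"
    using TX TABC cA cB' fin by (auto simp: P_def Q_def nsets_def)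
  have "Max P = c" "Min Q = c"
    unfolding P_def Q_def using fin Ac cB by (meson Max_insert2 Min_insert2 less_imp_le)+
  then have PA: "P - {Max P} = A" and QB: "Q - {Min Q} = B"
    using \<open>c \<notin> A\<close> \<open>c \<notin> B\<close> by (auto simp: P_def Q_def)
  \<comment> \<open>\<open>A' \<union> B\<close> is \<open>T\<close> without its minimum and
    \<open>A \<union> B'\<close> is \<open>T\<close> without its maximum. The shifts run from
    \<open>A\<close> to \<open>A'\<close> inside \<open>P\<close> and from \<open>B'\<close> to
    \<open>B\<close> inside \<open>Q\<close>.\<close>
  define A' where "A' = P - {Min P}"
  define B' where "B' = Q - {Max Q}"
  have "Min P \<in> P" "Max Q \<in> Q"
    using fin Min_in[of P] Max_in[of Q] unfolding P_def Q_def by blast+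
  then have cA': "card A' = h" and cB'': "card B' = h'"
    using PQ by (auto simp: A'_def B'_def nsets_def)
  have fin': "finite A'" "finite B'"
    using fin by (auto simp: A'_def B'_def P_def Q_def)
  have g: "g (C \<union> D) = marker_sum (\<phi> C) (\<psi> D)" and in_T: "C \<union> D \<in> nsets T (h + h')"
    if "C \<subseteq> T" "D \<subseteq> T" "finite C" "finite D" "card C = h" "card D = h'"
      "\<forall>a \<in> C. \<forall>b \<in> D. a < b" for C D
  proof -
    have "C \<inter> D = {}" using that by blast
    then have "C \<union> D - C = D" by blast
    then show "g (C \<union> D) = marker_sum (\<phi> C) (\<psi> D)"
      by (simp add: g_def lower_part_Un that)
    from \<open>C \<inter> D = {}\<close> show "C \<union> D \<in> nsets T (h + h')"
      using that by (auto simp: nsets_def card_Un_disjoint)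
  qed
  have sub: "A \<subseteq> T" "B \<subseteq> T" "A' \<subseteq> T" "B' \<subseteq> T"
    using TABC by (auto simp: A'_def B'_def P_def Q_def)
  have lt: "a < b" if "a \<in> A" "b \<in> Q" for a b
    using that Ac cB by (force simp: Q_def)
  have lt': "a < b" if "a \<in> P" "b \<in> B" for a b
    using that Ac cB by (force simp: P_def)
  have BQ: "B \<subseteq> Q" "B' \<subseteq> Q" and AP: "A' \<subseteq> P"
    by (auto simp: A'_def B'_def Q_def)
  have ltAB: "\<forall>a \<in> A. \<forall>b \<in> B. a < b" using lt BQ by blast
  have ltA'B: "\<forall>a \<in> A'. \<forall>b \<in> B. a < b" using lt' AP by blast
  have ltAB': "\<forall>a \<in> A. \<forall>b \<in> B'. a < b" using lt BQ by blast
  note AB = g[OF sub(1,2) fin cA cB' ltAB] in_T[OF sub(1,2) fin cA cB' ltAB]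
  note A'B = g[OF sub(3,2) fin'(1) fin(2) cA' cB' ltA'B]
    in_T[OF sub(3,2) fin'(1) fin(2) cA' cB' ltA'B]
  note AB' = g[OF sub(1,4) fin(1) fin'(2) cA cB'' ltAB']
    in_T[OF sub(1,4) fin(1) fin'(2) cA cB'' ltAB']
  have "marker_arc (\<phi> A, \<phi> A')" "marker_arc (\<psi> B', \<psi> B)"
    using \<phi>[OF PQ(1)] \<psi>[OF PQ(2)] unfolding PA QB A'_def B'_def by auto
  then have "g (A' \<union> B) \<noteq> g (A \<union> B) \<or> g (A \<union> B') \<noteq> g (A \<union> B)"
    unfolding AB(1) A'B(1) AB'(1) by (rule marker_sum_step)
  with mono AB(2) A'B(2) AB'(2) show False
    by blast
qed

lemma partn_lst_subset:
  assumes "partn_lst X qs k" and "X \<subseteq> Y"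
  shows "partn_lst Y qs k"
proof -
  have "f \<in> nsets X k \<rightarrow> {..<length qs}" if "f \<in> nsets Y k \<rightarrow> {..<length qs}" for f :: "'a set \<Rightarrow> nat"
    using that nsets_Pi_contra[OF assms(2)] by blast
  then show ?thesis
    using assms nsets_mono[OF assms(2)] unfolding partn_lst_def monochromatic_def by (meson subsetD)
qed

theorem mainTheorem3:
  fixes k :: nat
  assumes "k \<ge> 14"
  shows "ramsey_number k (k + 1) (k + 1) > (twr (k div 2 - 4) 2)\<^sup>2"
proof -
  define h where "h = k div 2"
  have "2 * h \<le> k"
    unfolding h_def by (rule times_div_less_eq_dividend)
  moreover have "14 div 2 \<le> h"
    unfolding h_def using assms by (rule div_le_mono)
  \<comment> \<open>The count of levels: start at 1, \<open>i\<close> tower steps, one step from 16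
    to 6 colours and four to \<open>marker_arc\<close>, in all \<open>i + 6\<close>. The tower index
    \<open>h - 4\<close> is then \<open>i + 2\<close>.\<close>
  ultimately obtain i where i: "h = i + 6" and h: "h \<le> k - h" "h + (k - h) = k"
    using le_Suc_ex[of 6 h] by (auto simp: add.commute)
  let ?N = "(twr (h - 4) 2)\<^sup>2"
  let ?X = "{1..?N}"
  have "shift_colourable ?X 1 (complete_arcs ((twr (Suc (Suc i)) 2)\<^sup>2))"
    using shift_colourable_complete[of ?N] by (simp add: i)
  then have "shift_colourable ?X (Suc i) (complete_arcs 16)"
    using shift_colourable_tower[of ?X 1 i] by simp
  \<comment> \<open>\<open>6 choose 3\<close> is 20, which is at least 16.\<close>
  then have "shift_colourable ?X (Suc i) (complete_arcs ((2 * 3) choose 3))"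
    by (rule shift_colourable_mono) (simp add: complete_arcs_mono numeral_eq_Suc)
  then have "shift_colourable ?X (i + 2) (complete_arcs 6)"
    using shift_colourable_central_binomial[of ?X "Suc i" 3] by simp
  then have low: "shift_colourable ?X h (Collect marker_arc)"
    using shift_colourable_marker_arc[of ?X "i + 2"] by (simp add: i add.commute)
  have "h \<ge> 1"
    by (simp add: i)
  with h(1) low have "shift_colourable ?X (k - h) (Collect marker_arc)"
    by (rule shift_colourable_le)
  with low have "\<not> partn_lst ?X [h + (k - h) + 1, h + (k - h) + 1] (h + (k - h))"
    by (rule not_partn_lst_halves)
  then have "\<not> partn_lst ?X [k + 1, k + 1] k"
    unfolding h(2) .
  moreover have "partn_lst ?X [k + 1, k + 1] k" if "ramsey_number k (k + 1) (k + 1) \<le> ?N"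
    using ramsey_number_partn[of k "k + 1" "k + 1"] that by (auto intro: partn_lst_subset)
  ultimately show ?thesis
    unfolding h_def by (meson not_le_imp_less)
qed

end
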